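(* Let $\mathcal{H}$ and $\mathcal{K}$ be closed subspaces of $L^2$ and let $\phi,\psi\in L^\infty$. Suppose that $T_\phi^{\mathcal{K}}$ and $T_\psi^{\mathcal{H}}$ are equivalent via $$E = T_{\bar a}^{\mathcal{H},\mathcal{K}} \quad\text{and}\quad F = T_a^{\mathcal{K},\mathcal{H}},$$ i.e. $T_\phi^{\mathcal{K}} = E\,T_\psi^{\mathcal{H}}F$, where $a\in \mathscr{G}L^\infty$ with $a\mathcal{K}=\mathcal{H}$. Also suppose that $C_{\mathcal{H}}$ is an antilinear unitary mapping on $\mathcal{H}$ such that $F^{-1}C_{\mathcal{H}}F = E C_{\mathcal{H}}E^{-1}$. Then $T_\psi^{\mathcal{H}}$ is complex selfadjoint with respect to $C_{\mathcal{H}}$ if and only if $T_\phi^{\mathcal{K}}$ is complex selfadjoint with respect to the antilinear unitary mapping $C_{\mathcal{K}} = F^{-1}C_{\mathcal{H}}F$.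
   Context: $L^2 = L^2(\mathbb{T}, m)$, with $m$ normalized Lebesgue measure on the unit circle $\mathbb{T}$, and $L^\infty = L^\infty(\mathbb{T},m)$ (complex-valued functions). $\mathscr{G}L^\infty = \{g \in L^\infty : 1/g \in L^\infty\}$, and $a\mathcal{K}=\{af:f\in\mathcal{K}\}$. $P_{\mathcal{N}}$ is the orthogonal projection of $L^2$ onto the closed subspace $\mathcal{N}$. For closed subspaces $\mathcal{M}, \mathcal{N}$ of $L^2$ and $\phi \in L^\infty$, $T_\phi^{\mathcal{M},\mathcal{N}} : \mathcal{M} \to \mathcal{N}$ is $T_\phi^{\mathcal{M},\mathcal{N}} f = P_{\mathcal{N}}(\phi f)$, and $T_\phi^{\mathcal{M}} = T_\phi^{\mathcal{M},\mathcal{M}}$. A mapping $C:\mathcal{K}\to\mathcal{K}$ is antilinear if $C(f+\lambda g) = Cf + \bar\lambda Cg$ for all $f,g\in\mathcal{K}$, $\lambda\in\mathbb{C}$; its antilinear adjoint $C^*$ satisfies $\langle Cf,g\rangle = \overline{\langle f, C^*g\rangle}$ for all $f,g\in\mathcal{K}$; $C$ is an antilinear unitary mapping if $C^*=C^{-1}$ (no involutivity is assumed). A bounded operator $T$ is complex selfadjoint with respect to an antilinear unitary mapping $C$ if $CTC^{-1}=T^*$. *)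

theory Defs
  imports "HOL-Analysis.Analysis"
begin

section \<open>The spaces $L^2$ and $L^\infty$ of the unit circle\<close>

definition circle_measure :: "complex measure" where
  "circle_measure =
     distr (uniform_measure lborel {0..<2 * pi}) (restrict_space borel (sphere 0 1)) cis"

definition square_integrable :: "(complex \<Rightarrow> complex) \<Rightarrow> bool" where
  "square_integrable f \<longleftrightarrow> f \<in> borel_measurable circle_measure \<and>
     integrable circle_measure (\<lambda>z. (cmod (f z))\<^sup>2)"

definition ess_bounded :: "(complex \<Rightarrow> complex) \<Rightarrow> bool" where
  "ess_bounded f \<longleftrightarrow> f \<in> borel_measurable circle_measure \<and>
     (\<exists>B. AE z in circle_measure. cmod (f z) \<le> B)"

definition L2_rel :: "(complex \<Rightarrow> complex) \<Rightarrow> (complex \<Rightarrow> complex) \<Rightarrow> bool" where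
  "L2_rel f g \<longleftrightarrow> square_integrable f \<and> square_integrable g \<and>
     (AE z in circle_measure. f z = g z)"

definition Linf_rel :: "(complex \<Rightarrow> complex) \<Rightarrow> (complex \<Rightarrow> complex) \<Rightarrow> bool" where
  "Linf_rel f g \<longleftrightarrow> ess_bounded f \<and> ess_bounded g \<and>
     (AE z in circle_measure. f z = g z)"

lemma square_integrable_zero: "square_integrable (\<lambda>_. 0)"
  by (simp add: square_integrable_def)

lemma ess_bounded_zero: "ess_bounded (\<lambda>_. 0)"
  by (auto simp: ess_bounded_def intro!: exI[of _ 0])

quotient_type L2 = "complex \<Rightarrow> complex" / partial: L2_rel
proof (rule part_equivpI)
  show "\<exists>f. L2_rel f f"
    using square_integrable_zero by (auto simp: L2_rel_def)
  show "symp L2_rel"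
    by (auto simp: symp_def L2_rel_def elim: eventually_mono)
  show "transp L2_rel"
    by (auto simp: transp_def L2_rel_def elim: eventually_elim2)
qed

quotient_type Linf = "complex \<Rightarrow> complex" / partial: Linf_rel
proof (rule part_equivpI)
  show "\<exists>f. Linf_rel f f"
    using ess_bounded_zero by (auto simp: Linf_rel_def)
  show "symp Linf_rel"
    by (auto simp: symp_def Linf_rel_def elim: eventually_mono)
  show "transp Linf_rel"
    by (auto simp: transp_def Linf_rel_def elim: eventually_elim2)
qed

lemma measurable_cnj [measurable]: "cnj \<in> borel_measurable borel"
  by (intro borel_measurable_continuous_onI continuous_intros)

lemma square_integrable_measurable [measurable_dest]:
  "square_integrable f \<Longrightarrow> f \<in> borel_measurable circle_measure"
  by (simp add: square_integrable_def)

lemma ess_bounded_measurable [measurable_dest]: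
  "ess_bounded f \<Longrightarrow> f \<in> borel_measurable circle_measure"
  by (simp add: ess_bounded_def)

lemma square_integrable_add:
  assumes [measurable]: "square_integrable f" "square_integrable g"
  shows "square_integrable (\<lambda>z. f z + g z)"
proof -
  have "integrable circle_measure (\<lambda>z. (cmod (f z + g z))\<^sup>2)"
  proof (rule Bochner_Integration.integrable_bound)
    show "integrable circle_measure (\<lambda>z. 2 * (cmod (f z))\<^sup>2 + 2 * (cmod (g z))\<^sup>2)"
      using assms by (auto simp: square_integrable_def)
    have "(cmod (f z + g z))\<^sup>2 \<le> 2 * (cmod (f z))\<^sup>2 + 2 * (cmod (g z))\<^sup>2" for z
    proof -
      have "(cmod (f z + g z))\<^sup>2 \<le> (cmod (f z) + cmod (g z))\<^sup>2"
        by (intro power_mono norm_triangle_ineq) auto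
      also have "\<dots> \<le> 2 * (cmod (f z))\<^sup>2 + 2 * (cmod (g z))\<^sup>2"
        using zero_le_power2[of "cmod (f z) - cmod (g z)"]
        by (simp add: power2_eq_square algebra_simps)
      finally show ?thesis .
    qed
    then show "AE z in circle_measure. norm ((cmod (f z + g z))\<^sup>2)
                 \<le> norm (2 * (cmod (f z))\<^sup>2 + 2 * (cmod (g z))\<^sup>2)"
      by auto
  qed measurable
  then show ?thesis by (simp add: square_integrable_def)
qed

lemma square_integrable_mult:
  assumes [measurable]: "ess_bounded f" "square_integrable g"
  shows "square_integrable (\<lambda>z. f z * g z)"
proof -
  obtain B where B: "AE z in circle_measure. cmod (f z) \<le> B"
    using assms by (auto simp: ess_bounded_def)
  have "integrable circle_measure (\<lambda>z. (cmod (f z * g z))\<^sup>2)"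
  proof (rule Bochner_Integration.integrable_bound)
    show "integrable circle_measure (\<lambda>z. B\<^sup>2 * (cmod (g z))\<^sup>2)"
      using assms by (auto simp: square_integrable_def)
    show "AE z in circle_measure. norm ((cmod (f z * g z))\<^sup>2) \<le> norm (B\<^sup>2 * (cmod (g z))\<^sup>2)"
      using B by eventually_elim
        (auto simp: norm_mult power_mult_distrib intro!: mult_right_mono power_mono)
  qed measurable
  then show ?thesis by (simp add: square_integrable_def)
qed

lemma ess_bounded_const: "ess_bounded (\<lambda>_. c)"
  by (auto simp: ess_bounded_def)

lemma square_integrable_cmult:
  "square_integrable f \<Longrightarrow> square_integrable (\<lambda>z. c * f z)"
  by (rule square_integrable_mult[OF ess_bounded_const])

lemma square_integrable_uminus: "square_integrable f \<Longrightarrow> square_integrable (\<lambda>z. - f z)"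
  using square_integrable_cmult[of f "-1"] by simp

lemma square_integrable_diff:
  "square_integrable f \<Longrightarrow> square_integrable g \<Longrightarrow> square_integrable (\<lambda>z. f z - g z)"
  using square_integrable_add[OF _ square_integrable_uminus, of f g] by simp

lemma integrable_mult_cnj:
  assumes [measurable]: "square_integrable f" "square_integrable g"
  shows "integrable circle_measure (\<lambda>z. f z * cnj (g z))"
proof (rule Bochner_Integration.integrable_bound)
  show "integrable circle_measure (\<lambda>z. (cmod (f z))\<^sup>2 + (cmod (g z))\<^sup>2)"
    using assms by (auto simp: square_integrable_def)
  have "cmod (f z) * cmod (g z) \<le> (cmod (f z))\<^sup>2 + (cmod (g z))\<^sup>2" for z
  proof -
    have "2 * cmod (f z) * cmod (g z) \<le> (cmod (f z))\<^sup>2 + (cmod (g z))\<^sup>2"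
      by (rule sum_squares_bound)
    moreover have "0 \<le> cmod (f z) * cmod (g z)" by simp
    ultimately show ?thesis by linarith
  qed
  then show "AE z in circle_measure. norm (f z * cnj (g z))
               \<le> norm ((cmod (f z))\<^sup>2 + (cmod (g z))\<^sup>2)"
    by (auto simp: norm_mult)
qed measurable

lift_definition cscale :: "complex \<Rightarrow> L2 \<Rightarrow> L2" is "\<lambda>c f z. c * f z"
  by (auto simp: L2_rel_def intro: square_integrable_cmult)

lift_definition cinner :: "L2 \<Rightarrow> L2 \<Rightarrow> complex"
  is "\<lambda>f g. integral\<^sup>L circle_measure (\<lambda>z. f z * cnj (g z))"
  by (intro integral_cong_AE) (auto simp: L2_rel_def)

lift_definition mult_op :: "Linf \<Rightarrow> L2 \<Rightarrow> L2" is "\<lambda>\<phi> f z. \<phi> z * f z"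
  by (auto simp: L2_rel_def Linf_rel_def intro: square_integrable_mult)

lift_definition cnj_Linf :: "Linf \<Rightarrow> Linf" is "\<lambda>\<phi> z. cnj (\<phi> z)"
  by (auto simp: Linf_rel_def ess_bounded_def)

text \<open>The condition \<open>\<phi> \<noteq> 0\<close> almost everywhere has to be stated separately, because
  \<open>1 / 0 = 0\<close> in HOL.\<close>

lift_definition GLinf :: "Linf \<Rightarrow> bool"
  is "\<lambda>\<phi>. (AE z in circle_measure. \<phi> z \<noteq> 0) \<and> ess_bounded (\<lambda>z. 1 / \<phi> z)"
proof -
  have "(AE z in circle_measure. \<psi> z \<noteq> 0) \<and> ess_bounded (\<lambda>z. 1 / \<psi> z)"
    if rel: "Linf_rel \<phi> \<psi>" and nz: "AE z in circle_measure. \<phi> z \<noteq> 0" and bd: "ess_bounded (\<lambda>z. 1 / \<phi> z)"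
    for \<phi> \<psi>
  proof -
    from rel have [measurable]: "\<psi> \<in> borel_measurable circle_measure"
      and eq: "AE z in circle_measure. \<phi> z = \<psi> z"
      by (auto simp: Linf_rel_def ess_bounded_def)
    obtain B where "AE z in circle_measure. cmod (1 / \<phi> z) \<le> B"
      using bd by (auto simp: ess_bounded_def)
    with eq have "AE z in circle_measure. cmod (1 / \<psi> z) \<le> B"
      by eventually_elim simp
    moreover from eq nz have "AE z in circle_measure. \<psi> z \<noteq> 0"
      by eventually_elim simp
    ultimately show ?thesis by (auto simp: ess_bounded_def)
  qed
  moreover have "Linf_rel \<psi> \<phi>" if "Linf_rel \<phi> \<psi>" for \<phi> \<psi>
    using that by (auto simp: Linf_rel_def elim: eventually_mono)
  ultimately show "Linf_rel \<phi> \<psi> \<Longrightarrow>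
      ((AE z in circle_measure. \<phi> z \<noteq> 0) \<and> ess_bounded (\<lambda>z. 1 / \<phi> z)) =
      ((AE z in circle_measure. \<psi> z \<noteq> 0) \<and> ess_bounded (\<lambda>z. 1 / \<psi> z))" for \<phi> \<psi>
    by blast
qed

text \<open>The real inner product on \<open>L2\<close> is the real part of \<open>cinner\<close>; it induces the usual
  \<open>L\<^sup>2\<close> norm and hence the usual notion of closed set.\<close>

instantiation L2 :: real_inner
begin

lift_definition zero_L2 :: L2 is "\<lambda>_. 0"
  by (auto simp: L2_rel_def square_integrable_zero)

lift_definition plus_L2 :: "L2 \<Rightarrow> L2 \<Rightarrow> L2" is "\<lambda>f g z. f z + g z"
  by (auto simp: L2_rel_def intro: square_integrable_add)

lift_definition uminus_L2 :: "L2 \<Rightarrow> L2" is "\<lambda>f z. - f z"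
  by (auto simp: L2_rel_def intro: square_integrable_uminus)

lift_definition minus_L2 :: "L2 \<Rightarrow> L2 \<Rightarrow> L2" is "\<lambda>f g z. f z - g z"
  by (auto simp: L2_rel_def intro: square_integrable_diff)

definition scaleR_L2 :: "real \<Rightarrow> L2 \<Rightarrow> L2" where
  "scaleR_L2 r = cscale (of_real r)"

definition inner_L2 :: "L2 \<Rightarrow> L2 \<Rightarrow> real" where
  "inner_L2 f g = Re (cinner f g)"

definition norm_L2 :: "L2 \<Rightarrow> real" where
  "norm_L2 f = sqrt (inner f f)"

definition dist_L2 :: "L2 \<Rightarrow> L2 \<Rightarrow> real" where
  "dist_L2 f g = norm (f - g)"

definition sgn_L2 :: "L2 \<Rightarrow> L2" where
  "sgn_L2 f = inverse (norm f) *\<^sub>R f"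

definition uniformity_L2 :: "(L2 \<times> L2) filter" where
  "uniformity_L2 = (INF e\<in>{0<..}. principal {(f, g). dist f g < e})"

definition open_L2 :: "L2 set \<Rightarrow> bool" where
  "open_L2 U \<longleftrightarrow> (\<forall>f\<in>U. eventually (\<lambda>(f', g). f' = f \<longrightarrow> g \<in> U) uniformity)"

instance
proof
  fix f g h :: L2 and r s :: real
  show "f + g + h = f + (g + h)"
    by transfer (auto simp: L2_rel_def algebra_simps intro: square_integrable_add)
  show "f + g = g + f"
    by transfer (auto simp: L2_rel_def algebra_simps intro: square_integrable_add)
  show "0 + f = f"
    by transfer (auto simp: L2_rel_def)
  show "- f + f = 0"
    by transfer (auto simp: L2_rel_def square_integrable_zero)
  show "f - g = f + - g"
    by transfer (auto simp: L2_rel_def intro: square_integrable_diff)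
  show "r *\<^sub>R (f + g) = r *\<^sub>R f + r *\<^sub>R g"
    unfolding scaleR_L2_def
    by transfer (auto simp: L2_rel_def distrib_left
        intro!: square_integrable_add square_integrable_cmult)
  show "(r + s) *\<^sub>R f = r *\<^sub>R f + s *\<^sub>R f"
    unfolding scaleR_L2_def
    by transfer (auto simp: L2_rel_def distrib_right
        intro!: square_integrable_add square_integrable_cmult)
  show "r *\<^sub>R s *\<^sub>R f = (r * s) *\<^sub>R f"
    unfolding scaleR_L2_def
    by transfer (auto simp: L2_rel_def mult.assoc intro!: square_integrable_cmult)
  show "1 *\<^sub>R f = f"
    unfolding scaleR_L2_def by transfer (auto simp: L2_rel_def)
  show "inner f g = inner g f"
    unfolding inner_L2_def
  proof transfer
    fix f g assume "L2_rel f f" "L2_rel g g"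
    then have i: "integrable circle_measure (\<lambda>z. f z * cnj (g z))"
      by (auto simp: L2_rel_def intro: integrable_mult_cnj)
    have "integral\<^sup>L circle_measure (\<lambda>z. g z * cnj (f z)) =
        integral\<^sup>L circle_measure (\<lambda>z. cnj (f z * cnj (g z)))"
      by (simp add: mult.commute)
    also have "\<dots> = cnj (integral\<^sup>L circle_measure (\<lambda>z. f z * cnj (g z)))"
      using i by (intro integral_bounded_linear bounded_linear_cnj)
    finally show "Re (integral\<^sup>L circle_measure (\<lambda>z. f z * cnj (g z))) =
        Re (integral\<^sup>L circle_measure (\<lambda>z. g z * cnj (f z)))"
      by simp
  qed
  show "inner (f + g) h = inner f h + inner g h"
    unfolding inner_L2_def
    by transfer (auto simp: L2_rel_def distrib_right integrable_mult_cnj)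
  show "inner (r *\<^sub>R f) g = r * inner f g"
    unfolding inner_L2_def scaleR_L2_def
    by transfer (auto simp: L2_rel_def mult.assoc integrable_mult_cnj)
  have sq: "integral\<^sup>L circle_measure (\<lambda>z. f z * cnj (f z)) =
      of_real (integral\<^sup>L circle_measure (\<lambda>z. (cmod (f z))\<^sup>2))" for f
    by (simp add: complex_norm_square [symmetric] flip: integral_complex_of_real)
  show "0 \<le> inner f f"
    unfolding inner_L2_def by transfer (simp add: sq)
  show "inner f f = 0 \<longleftrightarrow> f = 0"
    unfolding inner_L2_def
  proof transfer
    fix f assume "L2_rel f f"
    then have f: "square_integrable f" by (simp add: L2_rel_def)
    then have "integral\<^sup>L circle_measure (\<lambda>z. (cmod (f z))\<^sup>2) = 0 \<longleftrightarrow>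
        (AE z in circle_measure. (cmod (f z))\<^sup>2 = 0)"
      by (intro integral_nonneg_eq_0_iff_AE) (auto simp: square_integrable_def)
    with f show "Re (integral\<^sup>L circle_measure (\<lambda>z. f z * cnj (f z))) = 0 \<longleftrightarrow>
        L2_rel f (\<lambda>_. 0)"
      by (simp add: sq L2_rel_def square_integrable_zero)
  qed
qed (simp_all add: norm_L2_def dist_L2_def sgn_L2_def uniformity_L2_def open_L2_def)

end

interpretation L2: vector_space cscale
proof
  fix c d :: complex and f g :: L2
  show "cscale c (f + g) = cscale c f + cscale c g"
    by transfer (auto simp: L2_rel_def distrib_left
        intro!: square_integrable_add square_integrable_cmult)
  show "cscale (c + d) f = cscale c f + cscale d f"
    by transfer (auto simp: L2_rel_def distrib_right
        intro!: square_integrable_add square_integrable_cmult)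
  show "cscale c (cscale d f) = cscale (c * d) f"
    by transfer (auto simp: L2_rel_def mult.assoc intro!: square_integrable_cmult)
  show "cscale 1 f = f"
    by transfer (auto simp: L2_rel_def)
qed


section \<open>Operators on closed subspaces\<close>

definition closed_subspace :: "L2 set \<Rightarrow> bool" where
  "closed_subspace K \<longleftrightarrow> L2.subspace K \<and> closed K"

definition proj :: "L2 set \<Rightarrow> L2 \<Rightarrow> L2" where
  "proj N f = (THE p. p \<in> N \<and> (\<forall>g\<in>N. cinner (f - p) g = 0))"

definition toeplitz :: "L2 set \<Rightarrow> L2 set \<Rightarrow> Linf \<Rightarrow> L2 \<Rightarrow> L2" where
  "toeplitz M N \<phi> = (\<lambda>f\<in>M. proj N (mult_op \<phi> f))"

text \<open>A mapping on a subspace \<open>K\<close> is represented by a function on \<open>L2\<close> of which only the values on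
  \<open>K\<close> matter; the inverse of a mapping \<open>C\<close> defined on \<open>K\<close> is \<open>inv_into K C\<close>.\<close>

definition bounded_operator_on :: "L2 set \<Rightarrow> (L2 \<Rightarrow> L2) \<Rightarrow> bool" where
  "bounded_operator_on K T \<longleftrightarrow> T \<in> K \<rightarrow> K \<and>
     (\<forall>f\<in>K. \<forall>g\<in>K. \<forall>c. T (f + cscale c g) = T f + cscale c (T g)) \<and>
     (\<exists>B. \<forall>f\<in>K. norm (T f) \<le> B * norm f)"

definition is_adjoint_on :: "L2 set \<Rightarrow> (L2 \<Rightarrow> L2) \<Rightarrow> (L2 \<Rightarrow> L2) \<Rightarrow> bool" where
  "is_adjoint_on K T S \<longleftrightarrow> S \<in> K \<rightarrow> K \<and>
     (\<forall>f\<in>K. \<forall>g\<in>K. cinner (T f) g = cinner f (S g))"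

definition antilinear_on :: "L2 set \<Rightarrow> (L2 \<Rightarrow> L2) \<Rightarrow> bool" where
  "antilinear_on K C \<longleftrightarrow> C \<in> K \<rightarrow> K \<and>
     (\<forall>f\<in>K. \<forall>g\<in>K. \<forall>c. C (f + cscale c g) = C f + cscale (cnj c) (C g))"

definition is_antilinear_adjoint_on :: "L2 set \<Rightarrow> (L2 \<Rightarrow> L2) \<Rightarrow> (L2 \<Rightarrow> L2) \<Rightarrow> bool" where
  "is_antilinear_adjoint_on K C D \<longleftrightarrow> D \<in> K \<rightarrow> K \<and>
     (\<forall>f\<in>K. \<forall>g\<in>K. cinner (C f) g = cnj (cinner f (D g)))"

text \<open>Both kinds of adjoint are uniquely determined on \<open>K\<close>, so the equations \<open>C\<^sup>* = C\<^sup>-\<^sup>1\<close> and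
  \<open>T\<^sup>* = C T C\<^sup>-\<^sup>1\<close> below say that the right-hand side is an adjoint of \<open>C\<close> and \<open>T\<close>, respectively.\<close>

definition antilinear_unitary_on :: "L2 set \<Rightarrow> (L2 \<Rightarrow> L2) \<Rightarrow> bool" where
  "antilinear_unitary_on K C \<longleftrightarrow> antilinear_on K C \<and> bij_betw C K K \<and>
     is_antilinear_adjoint_on K C (inv_into K C)"

definition complex_selfadjoint_on :: "L2 set \<Rightarrow> (L2 \<Rightarrow> L2) \<Rightarrow> (L2 \<Rightarrow> L2) \<Rightarrow> bool" where
  "complex_selfadjoint_on K C T \<longleftrightarrow> bounded_operator_on K T \<and> antilinear_unitary_on K C \<and>
     is_adjoint_on K T (\<lambda>f. C (T (inv_into K C f)))"

end

theory Submission
  imports Defs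
begin

text \<open>
  Since \<open>aK = H\<close>, no projection is visible in \<open>F\<close>: it is multiplication by \<open>a\<close>, a bounded
  bijection of \<open>K\<close> onto \<open>H\<close> whose inverse \<open>G\<close> is multiplication by \<open>1/a\<close>. The operator \<open>E\<close> does
  involve a projection, but it is the adjoint of \<open>F\<close>; hence it is bijective as well, with inverse
  \<open>D\<close>, the adjoint of \<open>G\<close>.

  The hypothesis on \<open>C = C\<^sub>H\<close> says that the two ways of moving \<open>C\<close> to \<open>K\<close> agree:
  \<open>C\<^sub>K = G C F = E C D\<close>. Inverting, \<open>C\<^sub>K\<^sup>-\<^sup>1 = G C\<^sup>-\<^sup>1 F = E C\<^sup>-\<^sup>1 D\<close>. The antilinear adjoint of
  \<open>G C F\<close> is \<open>F\<^sup>* C\<^sup>* G\<^sup>* = E C\<^sup>-\<^sup>1 D\<close>, so \<open>C\<^sub>K\<close> is antilinear unitary. Choosing the suitable form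
  on each side of \<open>T\<^sub>\<phi> = E T\<^sub>\<psi> F\<close> makes the inner factors cancel,
  \[ C_K T_\phi C_K^{-1} = (E C D)(E T_\psi F)(G C^{-1} F) = E\,(C T_\psi C^{-1})\,F, \]
  while \<open>T\<^sub>\<phi>\<^sup>* = F\<^sup>* T\<^sub>\<psi>\<^sup>* E\<^sup>* = E T\<^sub>\<psi>\<^sup>* F\<close>. This carries complex selfadjointness from \<open>H\<close> to \<open>K\<close>
  (lemma \<open>transported_selfadjoint\<close>). The converse is the same lemma with \<open>(H, F, E)\<close> and
  \<open>(K, G, D)\<close> exchanged, because \<open>T\<^sub>\<psi> = D T\<^sub>\<phi> G\<close> and \<open>C = F C\<^sub>K G = D C\<^sub>K E\<close>.

  The analytic input is that orthogonal projections onto closed subspaces exist, so that \<open>E\<close> and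
  \<open>D\<close> take values in the right spaces and are adjoints. This needs the completeness of $L^2$
  (Riesz--Fischer) and the existence of a nearest point in a complete subspace.
\<close>

section \<open>The inner product of $L^2$\<close>

lemma cinner_commute: "cinner g f = cnj (cinner f g)"
proof transfer
  fix f g assume "L2_rel f f" "L2_rel g g"
  then have i: "integrable circle_measure (\<lambda>z. f z * cnj (g z))"
    by (auto simp: L2_rel_def intro: integrable_mult_cnj)
  have "integral\<^sup>L circle_measure (\<lambda>z. g z * cnj (f z)) =
      integral\<^sup>L circle_measure (\<lambda>z. cnj (f z * cnj (g z)))"
    by (simp add: mult.commute)
  also have "\<dots> = cnj (integral\<^sup>L circle_measure (\<lambda>z. f z * cnj (g z)))"
    using i by (intro integral_bounded_linear bounded_linear_cnj)
  finally show "integral\<^sup>L circle_measure (\<lambda>z. g z * cnj (f z)) =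
      cnj (integral\<^sup>L circle_measure (\<lambda>z. f z * cnj (g z)))" .
qed

lemma cinner_add_left: "cinner (f + g) h = cinner f h + cinner g h"
  by transfer (auto simp: L2_rel_def distrib_right integrable_mult_cnj)

lemma cinner_scale_left: "cinner (cscale c f) h = c * cinner f h"
  by transfer (auto simp: L2_rel_def mult.assoc integrable_mult_cnj)

lemma cinner_add_right: "cinner h (f + g) = cinner h f + cinner h g"
  by (metis cinner_add_left cinner_commute complex_cnj_add)

lemma cinner_scale_right: "cinner h (cscale c f) = cnj c * cinner h f"
  by (metis cinner_scale_left cinner_commute complex_cnj_mult)

lemma cinner_diff_left: "cinner (f - g) h = cinner f h - cinner g h"
  using cinner_add_left[of "f - g" g h] by simp

lemma cinner_diff_right: "cinner h (f - g) = cinner h f - cinner h g"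
  using cinner_add_right[of h "f - g" g] by simp

lemma cinner_zero_left [simp]: "cinner 0 h = 0"
  using cinner_diff_left[of 0 0 h] by simp

lemma cinner_self_eq_0D: "cinner f f = 0 \<Longrightarrow> f = 0"
  using inner_eq_zero_iff[of f] by (simp add: inner_L2_def)

lemma cinner_right_eqI:
  assumes "L2.subspace K" "f \<in> K" "g \<in> K" "\<And>h. h \<in> K \<Longrightarrow> cinner h f = cinner h g"
  shows "f = g"
proof -
  have "cinner (f - g) (f - g) = 0"
    using assms(4)[OF L2.subspace_diff[OF assms(1-3)]]
    by (simp add: cinner_diff_right)
  then have "f - g = 0" by (rule cinner_self_eq_0D)
  then show ?thesis by simp
qed

section \<open>Completeness of $L^2$\<close>

lemma square_integrable_rep: "square_integrable (rep_L2 f)"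
  using Quotient3_rep_reflp[OF Quotient3_L2, of f] by (simp add: L2_rel_def)

lemma abs_rep_L2: "abs_L2 (rep_L2 f) = f"
  by (rule Quotient3_abs_rep[OF Quotient3_L2])

text \<open>For explicit representatives the abstract norm becomes an integral; this is what connects
  the Hilbert space with the convergence theorems of measure theory.\<close>

lemma norm_abs_L2:
  assumes "square_integrable u"
  shows "(norm (abs_L2 u))\<^sup>2 = integral\<^sup>L circle_measure (\<lambda>z. (cmod (u z))\<^sup>2)"
proof -
  have r: "L2_rel u u" using assms by (simp add: L2_rel_def)
  have "(norm (abs_L2 u))\<^sup>2 = Re (cinner (abs_L2 u) (abs_L2 u))"
    by (simp add: power2_norm_eq_inner inner_L2_def)
  also have "\<dots> = Re (integral\<^sup>L circle_measure (\<lambda>z. u z * cnj (u z)))"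
    using cinner.abs_eq[OF r r] by simp
  also have "\<dots> = integral\<^sup>L circle_measure (\<lambda>z. (cmod (u z))\<^sup>2)"
    by (simp add: complex_norm_square [symmetric] flip: of_real_power)
  finally show ?thesis .
qed

lemma nn_integral_rep_diff:
  "(\<integral>\<^sup>+z. ennreal ((cmod (rep_L2 f z - rep_L2 g z))\<^sup>2) \<partial>circle_measure) =
     ennreal ((norm (f - g))\<^sup>2)"
proof -
  let ?w = "\<lambda>z. rep_L2 f z - rep_L2 g z"
  have w: "square_integrable ?w"
    by (intro square_integrable_diff square_integrable_rep)
  have "abs_L2 ?w = f - g"
    using minus_L2.abs_eq[of "rep_L2 f" "rep_L2 g"]
    by (simp add: L2_rel_def square_integrable_rep abs_rep_L2)
  with norm_abs_L2[OF w] w show ?thesis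
    by (subst nn_integral_eq_integral) (auto simp: square_integrable_def)
qed

lemma Cauchy_geometric_subseq:
  fixes X :: "nat \<Rightarrow> 'a::real_normed_vector"
  assumes "Cauchy X"
  shows "\<exists>r. strict_mono r \<and> (\<forall>n. norm (X (r (Suc n)) - X (r n)) \<le> (1/2) ^ n)"
proof -
  have "\<exists>M. \<forall>m\<ge>M. \<forall>n\<ge>M. norm (X m - X n) < (1/2)^k" for k :: nat
    using assms by (auto simp: Cauchy_iff)
  then obtain M where M: "\<And>k m n. m \<ge> M k \<Longrightarrow> n \<ge> M k \<Longrightarrow> norm (X m - X n) < (1/2)^k"
    by metis
  define r where "r = rec_nat (M 0) (\<lambda>k x. max (Suc x) (M (Suc k)))"
  have r_Suc: "r (Suc k) = max (Suc (r k)) (M (Suc k))" for k by (simp add: r_def)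
  have r_ge: "r k \<ge> M k" for k by (cases k) (auto simp: r_def)
  have mono: "strict_mono r" by (rule strict_monoI_Suc) (simp add: r_Suc)
  have "norm (X (r (Suc n)) - X (r n)) \<le> (1/2)^n" for n
  proof -
    have "r n \<le> r (Suc n)" by (simp add: r_Suc)
    with r_ge[of n] have "M n \<le> r (Suc n)" by linarith
    with M[of n "r (Suc n)" "r n"] r_ge[of n] show ?thesis by simp
  qed
  with mono show ?thesis by blast
qed

text \<open>If the increments \<open>w\<^sub>n\<close> satisfy \<open>\<parallel>w\<^sub>n\<parallel> \<le> 2\<^sup>-\<^sup>n\<close>, then \<open>\<Sum>\<^sub>n 2\<^sup>n \<bar>w\<^sub>n\<bar>\<^sup>2\<close> has integral at most
  \<open>\<Sum>\<^sub>n 2\<^sup>-\<^sup>n\<close>, hence is finite almost everywhere. The pointwise inequality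
  \<open>\<bar>w\<^sub>n\<bar> \<le> 2\<^sup>n \<bar>w\<^sub>n\<bar>\<^sup>2 + 2\<^sup>-\<^sup>n\<close> turns this into absolute convergence of \<open>\<Sum>\<^sub>n w\<^sub>n\<close>, without an appeal
  to Minkowski's inequality for infinite sums.\<close>

lemma AE_convergent_of_geometric:
  assumes le: "\<And>n. norm (Y (Suc n) - Y n) \<le> (1/2) ^ n"
  shows "AE z in circle_measure. convergent (\<lambda>n. rep_L2 (Y n) z)"
proof -
  let ?M = circle_measure
  define w where "w n z = rep_L2 (Y (Suc n)) z - rep_L2 (Y n) z" for n z
  have [measurable]: "w n \<in> borel_measurable ?M" for n
    unfolding w_def using square_integrable_rep[THEN square_integrable_measurable]
    by measurable
  have int: "(\<integral>\<^sup>+z. ennreal (2^n * (cmod (w n z))\<^sup>2) \<partial>?M) \<le> ennreal ((1/2)^n)" for n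
  proof -
    have "(\<integral>\<^sup>+z. ennreal (2^n * (cmod (w n z))\<^sup>2) \<partial>?M) =
        ennreal (2^n) * ennreal ((norm (Y (Suc n) - Y n))\<^sup>2)"
      unfolding nn_integral_rep_diff[symmetric] w_def[symmetric]
      by (subst nn_integral_cmult[symmetric]) (auto simp: ennreal_mult)
    also have "\<dots> \<le> ennreal (2^n) * ennreal (((1/2)^n)\<^sup>2)"
      by (intro mult_left_mono ennreal_leI power_mono le) auto
    also have "\<dots> = ennreal ((1/2)^n)"
      by (simp add: ennreal_mult[symmetric] power2_eq_square power_one_over)
    finally show ?thesis .
  qed
  have "(\<integral>\<^sup>+z. (\<Sum>n. ennreal (2^n * (cmod (w n z))\<^sup>2)) \<partial>?M) =
      (\<Sum>n. \<integral>\<^sup>+z. ennreal (2^n * (cmod (w n z))\<^sup>2) \<partial>?M)"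
    by (rule nn_integral_suminf) measurable
  also have "\<dots> \<le> (\<Sum>n. ennreal ((1/2)^n))"
    by (intro suminf_le int) auto
  also have "\<dots> < \<infinity>"
    by (subst suminf_ennreal2) (auto simp: summable_geometric)
  finally have "AE z in ?M. (\<Sum>n. ennreal (2^n * (cmod (w n z))\<^sup>2)) \<noteq> \<infinity>"
    by (intro nn_integral_PInf_AE) auto
  then show ?thesis
  proof eventually_elim
    case (elim z)
    then have "summable (\<lambda>n. 2^n * (cmod (w n z))\<^sup>2)"
      by (intro summable_suminf_not_top) auto
    then have "summable (\<lambda>n. 2^n * (cmod (w n z))\<^sup>2 + (1/2)^n)"
      by (intro summable_add) (auto simp: summable_geometric)
    moreover have "norm (w n z) \<le> 2^n * (cmod (w n z))\<^sup>2 + (1/2)^n" for n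
    proof -
      \<comment> \<open>complete the square, using \<open>2\<^sup>n 2\<^sup>-\<^sup>n = 1\<close>\<close>
      have "2^n * (cmod (w n z))\<^sup>2 + (1/2)^n - 2 * cmod (w n z) =
          2^n * (cmod (w n z) - (1/2)^n)\<^sup>2"
        by (simp add: power2_eq_square algebra_simps power_one_over)
      moreover have "0 \<le> 2^n * (cmod (w n z) - (1/2)^n)\<^sup>2" by simp
      ultimately show ?thesis using norm_ge_zero[of "w n z"] by linarith
    qed
    ultimately have "summable (\<lambda>n. w n z)"
      by (rule summable_comparison_test'[where N = 0])
    then have "convergent (\<lambda>n. \<Sum>k<n. w k z)"
      by (simp add: summable_iff_convergent)
    also have "(\<lambda>n. \<Sum>k<n. w k z) = (\<lambda>n. rep_L2 (Y n) z - rep_L2 (Y 0) z)"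
      by (simp add: w_def sum_lessThan_telescope[where f = "\<lambda>n. rep_L2 (Y n) z"])
    finally have "convergent (\<lambda>n. (rep_L2 (Y n) z - rep_L2 (Y 0) z) + rep_L2 (Y 0) z)"
      by (intro convergent_add convergent_const)
    then show ?case by simp
  qed
qed

text \<open>Fatou's lemma, applied to \<open>\<bar>Y\<^sub>m - Y\<^sub>n\<bar>\<^sup>2\<close> as \<open>m \<rightarrow> \<infinity>\<close>, bounds \<open>\<parallel>v - Y\<^sub>n\<parallel>\<close> by every bound for the
  tail distances \<open>\<parallel>Y\<^sub>m - Y\<^sub>n\<parallel>\<close>. Finiteness of one such bound makes \<open>v\<close> square integrable, smallness
  makes \<open>Y\<close> converge to it.\<close>

lemma AE_limit_of_Cauchy:
  assumes Y: "Cauchy Y" and [measurable]: "v \<in> borel_measurable circle_measure"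
    and lim: "AE z in circle_measure. (\<lambda>n. rep_L2 (Y n) z) \<longlonglongrightarrow> v z"
  shows "square_integrable v" "Y \<longlonglongrightarrow> abs_L2 v"
proof -
  let ?M = circle_measure
  have [measurable]: "rep_L2 f \<in> borel_measurable ?M" for f
    by (rule square_integrable_measurable[OF square_integrable_rep])
  have Fatou: "(\<integral>\<^sup>+z. ennreal ((cmod (v z - rep_L2 (Y n) z))\<^sup>2) \<partial>?M) \<le> ennreal (e\<^sup>2)"
    if e: "\<And>m. m \<ge> n \<Longrightarrow> norm (Y m - Y n) \<le> e" for n e
  proof -
    have "(\<integral>\<^sup>+z. ennreal ((cmod (v z - rep_L2 (Y n) z))\<^sup>2) \<partial>?M) =
        (\<integral>\<^sup>+z. liminf (\<lambda>m. ennreal ((cmod (rep_L2 (Y m) z - rep_L2 (Y n) z))\<^sup>2)) \<partial>?M)"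
      using lim
    proof (intro nn_integral_cong_AE, eventually_elim)
      case (elim z)
      then have "(\<lambda>m. ennreal ((cmod (rep_L2 (Y m) z - rep_L2 (Y n) z))\<^sup>2))
          \<longlonglongrightarrow> ennreal ((cmod (v z - rep_L2 (Y n) z))\<^sup>2)"
        by (intro tendsto_ennrealI tendsto_intros)
      then show ?case by (rule lim_imp_Liminf[OF sequentially_bot, symmetric])
    qed
    also have "\<dots> \<le> liminf (\<lambda>m. \<integral>\<^sup>+z. ennreal ((cmod (rep_L2 (Y m) z - rep_L2 (Y n) z))\<^sup>2) \<partial>?M)"
      by (rule nn_integral_liminf) measurable
    also have "\<dots> = liminf (\<lambda>m. ennreal ((norm (Y m - Y n))\<^sup>2))"
      by (simp add: nn_integral_rep_diff)
    also have "\<dots> \<le> liminf (\<lambda>m. ennreal (e\<^sup>2))"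
      by (intro Liminf_mono eventually_sequentiallyI[of n] ennreal_leI power_mono e) auto
    also have "\<dots> = ennreal (e\<^sup>2)" by (simp add: Liminf_const)
    finally show ?thesis .
  qed
  have sq: "square_integrable (\<lambda>z. v z - rep_L2 (Y n) z)"
    if "\<And>m. m \<ge> n \<Longrightarrow> norm (Y m - Y n) \<le> e" for n e
    using le_less_trans[OF Fatou[OF that] ennreal_less_top]
    by (auto simp: square_integrable_def integrable_iff_bounded)
  obtain N where "\<And>m. m \<ge> N \<Longrightarrow> norm (Y m - Y N) < 1"
    using Y[THEN CauchyD, of 1] by auto
  then have "square_integrable (\<lambda>z. v z - rep_L2 (Y N) z)"
    by (intro sq[of N 1]) (auto intro: less_imp_le)
  from square_integrable_add[OF this square_integrable_rep[of "Y N"]]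
  show v: "square_integrable v" by simp
  show "Y \<longlonglongrightarrow> abs_L2 v"
  proof (rule LIMSEQ_I)
    fix e :: real assume "0 < e"
    then obtain N where N: "\<And>m n. m \<ge> N \<Longrightarrow> n \<ge> N \<Longrightarrow> norm (Y m - Y n) < e / 2"
      using Y[THEN CauchyD, of "e/2"] by auto
    have "norm (Y n - abs_L2 v) < e" if "n \<ge> N" for n
    proof -
      have b: "norm (Y m - Y n) \<le> e / 2" if "m \<ge> n" for m
        using N[of m n] that \<open>n \<ge> N\<close> by simp
      have "abs_L2 (\<lambda>z. v z - rep_L2 (Y n) z) = abs_L2 v - Y n"
        using minus_L2.abs_eq[of v "rep_L2 (Y n)"]
        by (simp add: L2_rel_def square_integrable_rep abs_rep_L2 v)
      with norm_abs_L2[OF sq[OF b]] sq[OF b]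
      have "ennreal ((norm (abs_L2 v - Y n))\<^sup>2) =
          (\<integral>\<^sup>+z. ennreal ((cmod (v z - rep_L2 (Y n) z))\<^sup>2) \<partial>?M)"
        by (subst nn_integral_eq_integral) (auto simp: square_integrable_def)
      also have "\<dots> \<le> ennreal ((e/2)\<^sup>2)" by (rule Fatou[OF b])
      finally have "(norm (abs_L2 v - Y n))\<^sup>2 \<le> (e/2)\<^sup>2" by simp
      then have "norm (abs_L2 v - Y n) \<le> e / 2"
        using \<open>0 < e\<close> by (auto dest!: power2_le_imp_le)
      then show ?thesis using \<open>0 < e\<close> by (simp add: norm_minus_commute)
    qed
    then show "\<exists>N. \<forall>n\<ge>N. norm (Y n - abs_L2 v) < e" by blast
  qed
qed

text \<open>A rapidly converging subsequence has an almost everywhere limit, which is then its limit in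
  norm; a Cauchy sequence inherits the limit of a subsequence.\<close>

instance L2 :: complete_space
proof
  fix X :: "nat \<Rightarrow> L2" assume X: "Cauchy X"
  from Cauchy_geometric_subseq[OF X] obtain r
    where r: "strict_mono r" "\<And>n. norm (X (r (Suc n)) - X (r n)) \<le> (1/2) ^ n" by blast
  define Y where "Y = X \<circ> r"
  have Y: "Cauchy Y" unfolding Y_def using X r(1) by (rule Cauchy_subseq_Cauchy)
  define v where "v z = lim (\<lambda>n. rep_L2 (Y n) z)" for z
  have "AE z in circle_measure. convergent (\<lambda>n. rep_L2 (Y n) z)"
    using r(2) by (intro AE_convergent_of_geometric) (simp add: Y_def)
  then have "AE z in circle_measure. (\<lambda>n. rep_L2 (Y n) z) \<longlonglongrightarrow> v z"
    by (simp add: v_def convergent_LIMSEQ_iff)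
  moreover have "v \<in> borel_measurable circle_measure"
    unfolding v_def
    by (intro borel_measurable_lim_metric square_integrable_measurable square_integrable_rep)
  ultimately have "Y \<longlonglongrightarrow> abs_L2 v" by (intro AE_limit_of_Cauchy(2)[OF Y])
  then have "X \<longlonglongrightarrow> abs_L2 v"
    using Cauchy_converges_subseq[OF X r(1)] by (simp add: Y_def comp_def)
  then show "convergent X" by (auto simp: convergent_def)
qed

section \<open>Orthogonal projections\<close>

text \<open>Moving from \<open>p\<close> along \<open>g\<close> by \<open>t = \<langle>f - p, g\<rangle> / \<langle>g, g\<rangle>\<close>, the step that minimizes the distance to
  \<open>f\<close> on this line, lowers the squared distance by \<open>\<langle>f - p, g\<rangle>\<^sup>2 / \<langle>g, g\<rangle>\<close>.\<close>

lemma minimizer_orthogonal: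
  fixes S :: "'a::real_inner set"
  assumes S: "subspace S" "p \<in> S" "g \<in> S" and min: "\<And>q. q \<in> S \<Longrightarrow> norm (f - p) \<le> norm (f - q)"
  shows "inner (f - p) g = 0"
proof (cases "g = 0")
  case False
  define t where "t = inner (f - p) g / inner g g"
  have "p + t *\<^sub>R g \<in> S" using S by (intro subspace_add subspace_mul)
  from min[OF this] have "(norm (f - p))\<^sup>2 \<le> (norm (f - (p + t *\<^sub>R g)))\<^sup>2"
    by (intro power_mono) auto
  also have "\<dots> = (norm (f - p))\<^sup>2 - 2 * t * inner (f - p) g + t\<^sup>2 * inner g g"
    unfolding power2_norm_eq_inner
    by (simp add: inner_diff inner_add inner_commute algebra_simps power2_eq_square)
  also have "\<dots> = (norm (f - p))\<^sup>2 - (inner (f - p) g)\<^sup>2 / inner g g"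
    using False by (simp add: t_def power2_eq_square field_simps)
  finally have "(inner (f - p) g)\<^sup>2 / inner g g \<le> 0" by simp
  moreover have "inner g g > 0" using False by simp
  ultimately show ?thesis by (simp add: divide_le_0_iff)
qed simp

text \<open>A minimizing sequence is Cauchy by the parallelogram law, because the midpoint of two of its
  members lies in \<open>S\<close> and so is no closer to \<open>f\<close> than the infimum of the distances.\<close>

lemma complete_subspace_minimizer:
  fixes S :: "'a::real_inner set"
  assumes S: "complete S" "subspace S"
  shows "\<exists>p\<in>S. \<forall>q\<in>S. norm (f - p) \<le> norm (f - q)"
proof -
  have ne: "S \<noteq> {}" using subspace_0[OF S(2)] by blast
  define d where "d = infdist f S"
  have d_le: "d \<le> norm (f - q)" if "q \<in> S" for q
    using infdist_le[OF that, of f] by (simp add: d_def dist_norm)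
  have d0: "0 \<le> d" by (simp add: d_def infdist_nonneg)
  have "\<exists>x\<in>S. norm (f - x) < d + 1 / real (Suc n)" for n
  proof (rule ccontr)
    assume "\<not> ?thesis"
    then have "d + 1 / real (Suc n) \<le> infdist f S"
      unfolding infdist_notempty[OF ne]
      by (intro cINF_greatest ne) (auto simp: dist_norm not_less)
    then show False by (simp add: d_def)
  qed
  then obtain x where x: "\<And>n. x n \<in> S" "\<And>n. norm (f - x n) < d + 1 / real (Suc n)"
    by metis
  have lim: "(\<lambda>n. norm (f - x n)) \<longlonglongrightarrow> d"
  proof (rule tendsto_sandwich[OF _ _ tendsto_const])
    show "\<forall>\<^sub>F n in sequentially. d \<le> norm (f - x n)" using d_le x(1) by simp
    show "\<forall>\<^sub>F n in sequentially. norm (f - x n) \<le> d + 1 / real (Suc n)"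
      using x(2) by (intro always_eventually allI less_imp_le)
    show "(\<lambda>n. d + 1 / real (Suc n)) \<longlonglongrightarrow> d"
      using tendsto_add[OF tendsto_const LIMSEQ_inverse_real_of_nat, of d]
      by (simp add: inverse_eq_divide)
  qed
  have par: "(norm (x m - x n))\<^sup>2 \<le> 2 * (norm (f - x m))\<^sup>2 + 2 * (norm (f - x n))\<^sup>2 - 4 * d\<^sup>2"
    for m n
  proof -
    have "(1/2) *\<^sub>R (x m + x n) \<in> S" using x S by (intro subspace_mul subspace_add)
    then have "d\<^sup>2 \<le> (norm (f - (1/2) *\<^sub>R (x m + x n)))\<^sup>2"
      by (intro power_mono d_le d0)
    moreover have "(norm (x m - x n))\<^sup>2 = 2 * (norm (f - x m))\<^sup>2 + 2 * (norm (f - x n))\<^sup>2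
        - 4 * (norm (f - (1/2) *\<^sub>R (x m + x n)))\<^sup>2"
      unfolding power2_norm_eq_inner
      by (simp add: inner_diff inner_add inner_commute algebra_simps)
    ultimately show ?thesis by linarith
  qed
  have "Cauchy x"
  proof (rule CauchyI)
    fix e :: real assume e: "0 < e"
    have "(\<lambda>n. (norm (f - x n))\<^sup>2) \<longlonglongrightarrow> d\<^sup>2" by (intro tendsto_intros lim)
    then have "\<forall>\<^sub>F n in sequentially. (norm (f - x n))\<^sup>2 < d\<^sup>2 + e\<^sup>2 / 4"
      using e by (intro order_tendstoD) auto
    then obtain N where N: "\<And>n. n \<ge> N \<Longrightarrow> (norm (f - x n))\<^sup>2 < d\<^sup>2 + e\<^sup>2 / 4"
      by (auto simp: eventually_sequentially)
    have "norm (x m - x n) < e" if "m \<ge> N" "n \<ge> N" for m n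
    proof (rule power2_less_imp_less)
      show "(norm (x m - x n))\<^sup>2 < e\<^sup>2" using par[of m n] N[OF that(1)] N[OF that(2)] by linarith
    qed (use e in simp)
    then show "\<exists>M. \<forall>m\<ge>M. \<forall>n\<ge>M. norm (x m - x n) < e" by blast
  qed
  with S(1) x(1) obtain p where p: "p \<in> S" "x \<longlonglongrightarrow> p" unfolding complete_def by blast
  have "(\<lambda>n. norm (f - x n)) \<longlonglongrightarrow> norm (f - p)" by (intro tendsto_intros p)
  with lim have "norm (f - p) = d" by (rule LIMSEQ_unique[rotated])
  with p(1) d_le show ?thesis by auto
qed

lemma closed_subspace_imp_real_subspace: "closed_subspace K \<Longrightarrow> subspace K"
  by (auto simp: closed_subspace_def subspace_def scaleR_L2_def L2.subspace_def)

text \<open>Minimality only controls the real part of the complex inner product. The imaginary part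
  vanishes because the subspace contains \<open>\<i>g\<close> together with \<open>g\<close>.\<close>

lemma proj_ex1:
  assumes N: "closed_subspace N"
  shows "\<exists>!p. p \<in> N \<and> (\<forall>g\<in>N. cinner (f - p) g = 0)"
proof (rule ex_ex1I)
  have sub: "L2.subspace N" using N by (simp add: closed_subspace_def)
  have rsub: "subspace N" using N by (rule closed_subspace_imp_real_subspace)
  have "complete N" using N by (simp add: closed_subspace_def complete_eq_closed)
  from complete_subspace_minimizer[OF this rsub, of f] obtain p
    where p: "p \<in> N" "\<And>q. q \<in> N \<Longrightarrow> norm (f - p) \<le> norm (f - q)" by blast
  have "cinner (f - p) g = 0" if g: "g \<in> N" for g
  proof -
    have "Re (cinner (f - p) g) = 0"
      using minimizer_orthogonal[OF rsub p(1) g p(2)] by (simp add: inner_L2_def)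
    moreover have "Re (cinner (f - p) (cscale \<i> g)) = 0"
      using minimizer_orthogonal[OF rsub p(1) L2.subspace_scale[OF sub g] p(2)]
      by (simp add: inner_L2_def)
    ultimately show ?thesis by (simp add: cinner_scale_right complex_eq_iff)
  qed
  with p(1) show "\<exists>p. p \<in> N \<and> (\<forall>g\<in>N. cinner (f - p) g = 0)" by blast
  show "p = q" if pq: "p \<in> N \<and> (\<forall>g\<in>N. cinner (f - p) g = 0)"
    "q \<in> N \<and> (\<forall>g\<in>N. cinner (f - q) g = 0)" for p q
  proof (rule cinner_right_eqI[OF sub])
    show "cinner h p = cinner h q" if h: "h \<in> N" for h
    proof -
      have "cinner p h = cinner q h"
        using pq h by (auto simp: cinner_diff_left)
      then show ?thesis by (metis cinner_commute)
    qed
  qed (use pq in auto)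
qed

lemma
  assumes "closed_subspace N"
  shows proj_in: "proj N f \<in> N"
    and cinner_proj_left: "g \<in> N \<Longrightarrow> cinner (proj N f) g = cinner f g"
  using theI'[OF proj_ex1[OF assms, of f]] by (auto simp: proj_def cinner_diff_left)

lemma cinner_proj_right:
  "closed_subspace N \<Longrightarrow> g \<in> N \<Longrightarrow> cinner g (proj N f) = cinner g f"
  by (metis cinner_proj_left cinner_commute)

lemma proj_eq_self:
  assumes "closed_subspace N" "f \<in> N" shows "proj N f = f"
  unfolding proj_def
  by (rule the1_equality[OF proj_ex1[OF assms(1)]]) (simp add: assms(2) cinner_diff_left)

lemma norm_proj_le:
  assumes "closed_subspace N" shows "norm (proj N f) \<le> norm f"
proof -
  have "(norm (proj N f))\<^sup>2 = inner f (proj N f)"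
    using cinner_proj_left[OF assms proj_in[OF assms, of f], of f]
    by (simp add: power2_norm_eq_inner inner_L2_def)
  also have "\<dots> \<le> norm f * norm (proj N f)" by (rule norm_cauchy_schwarz)
  finally show ?thesis
    by (cases "norm (proj N f) = 0") (auto simp: power2_eq_square)
qed

section \<open>Multiplication and Toeplitz operators\<close>

lemma cinner_mult_op: "cinner (mult_op \<phi> f) g = cinner f (mult_op (cnj_Linf \<phi>) g)"
  by transfer (simp add: mult_ac)

lemma norm_mult_op_bounded: "\<exists>B\<ge>0. \<forall>f. norm (mult_op \<phi> f) \<le> B * norm f"
proof -
  define p where "p = rep_Linf \<phi>"
  have p: "ess_bounded p" "Linf_rel p p" "abs_Linf p = \<phi>"
    using Quotient3_rep_reflp[OF Quotient3_Linf, of \<phi>] Quotient3_abs_rep[OF Quotient3_Linf, of \<phi>]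
    by (auto simp: p_def Linf_rel_def)
  then obtain B where B: "AE z in circle_measure. cmod (p z) \<le> B"
    by (auto simp: ess_bounded_def)
  have "norm (mult_op \<phi> f) \<le> \<bar>B\<bar> * norm f" for f
  proof -
    define u where "u = rep_L2 f"
    have u: "square_integrable u" "L2_rel u u" "abs_L2 u = f"
      by (auto simp: u_def L2_rel_def square_integrable_rep abs_rep_L2)
    have pu: "square_integrable (\<lambda>z. p z * u z)" using p u by (intro square_integrable_mult)
    have "mult_op \<phi> f = abs_L2 (\<lambda>z. p z * u z)"
      using mult_op.abs_eq[OF p(2) u(2)] p u by simp
    then have "(norm (mult_op \<phi> f))\<^sup>2 = integral\<^sup>L circle_measure (\<lambda>z. (cmod (p z * u z))\<^sup>2)"
      using norm_abs_L2[OF pu] by simp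
    also have "\<dots> \<le> integral\<^sup>L circle_measure (\<lambda>z. B\<^sup>2 * (cmod (u z))\<^sup>2)"
    proof (rule integral_mono_AE)
      show "AE z in circle_measure. (cmod (p z * u z))\<^sup>2 \<le> B\<^sup>2 * (cmod (u z))\<^sup>2"
        using B by eventually_elim
          (auto simp: norm_mult power_mult_distrib intro!: mult_right_mono power_mono)
    qed (use pu u in \<open>auto simp: square_integrable_def\<close>)
    also have "\<dots> = (\<bar>B\<bar> * norm f)\<^sup>2"
      using norm_abs_L2[OF u(1)] u by (simp add: power_mult_distrib)
    finally show ?thesis by (auto dest!: power2_le_imp_le)
  qed
  then show ?thesis by (intro exI[of _ "\<bar>B\<bar>"]) auto
qed

lemma GLinf_inverse:
  assumes "GLinf a"
  shows "\<exists>b. \<forall>f. mult_op b (mult_op a f) = f \<and> mult_op a (mult_op b f) = f"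
proof -
  define p where "p = rep_Linf a"
  have p: "ess_bounded p" "Linf_rel p p" "abs_Linf p = a"
    using Quotient3_rep_reflp[OF Quotient3_Linf, of a] Quotient3_abs_rep[OF Quotient3_Linf, of a]
    by (auto simp: p_def Linf_rel_def)
  from GLinf.abs_eq[OF p(2)] assms p(3)
  have nz: "AE z in circle_measure. p z \<noteq> 0" and q: "ess_bounded (\<lambda>z. 1 / p z)" by auto
  define b where "b = abs_Linf (\<lambda>z. 1 / p z)"
  have qq: "Linf_rel (\<lambda>z. 1 / p z) (\<lambda>z. 1 / p z)" using q by (simp add: Linf_rel_def)
  have "mult_op b (mult_op a f) = f \<and> mult_op a (mult_op b f) = f" for f
  proof -
    define u where "u = rep_L2 f"
    have u: "square_integrable u" "L2_rel u u" "abs_L2 u = f"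
      by (auto simp: u_def L2_rel_def square_integrable_rep abs_rep_L2)
    have pu: "square_integrable (\<lambda>z. p z * u z)" "square_integrable (\<lambda>z. 1 / p z * u z)"
      using square_integrable_mult[OF p(1) u(1)] square_integrable_mult[OF q u(1)] .
    have pqu: "square_integrable (\<lambda>z. 1 / p z * (p z * u z))"
        "square_integrable (\<lambda>z. p z * (1 / p z * u z))"
      using square_integrable_mult[OF q pu(1)] square_integrable_mult[OF p(1) pu(2)] .
    have a: "mult_op a (abs_L2 w) = abs_L2 (\<lambda>z. p z * w z)" if "square_integrable w" for w
      using mult_op.abs_eq[OF p(2), of w] that p(3) by (simp add: L2_rel_def)
    have b: "mult_op b (abs_L2 w) = abs_L2 (\<lambda>z. 1 / p z * w z)" if "square_integrable w" for w
      using mult_op.abs_eq[OF qq, of w] that by (simp add: L2_rel_def b_def)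
    have "mult_op b (mult_op a f) = abs_L2 (\<lambda>z. 1 / p z * (p z * u z))"
      using a[OF u(1)] b[OF pu(1)] u(3) by simp
    also have "\<dots> = abs_L2 u"
      using nz pqu u by (intro Quotient3_rel_abs[OF Quotient3_L2])
        (auto simp: L2_rel_def elim: eventually_mono)
    finally have left: "mult_op b (mult_op a f) = f" using u(3) by simp
    have "mult_op a (mult_op b f) = abs_L2 (\<lambda>z. p z * (1 / p z * u z))"
      using b[OF u(1)] a[OF pu(2)] u(3) by simp
    also have "\<dots> = abs_L2 u"
      using nz pqu u by (intro Quotient3_rel_abs[OF Quotient3_L2])
        (auto simp: L2_rel_def elim: eventually_mono)
    finally show ?thesis using left u(3) by simp
  qed
  then show ?thesis by blast
qed

text \<open>Carrying the adjoint along as a second map gives linearity of both maps for free: elements of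
  a subspace are determined by their inner products with the subspace.\<close>

definition adjoint_between ::
    "L2 set \<Rightarrow> L2 set \<Rightarrow> (L2 \<Rightarrow> L2) \<Rightarrow> (L2 \<Rightarrow> L2) \<Rightarrow> bool" where
  "adjoint_between M N F E \<longleftrightarrow> F \<in> M \<rightarrow> N \<and> E \<in> N \<rightarrow> M \<and>
     (\<forall>f\<in>M. \<forall>h\<in>N. cinner (F f) h = cinner f (E h))"

lemma adjoint_between_sym:
  assumes "adjoint_between M N F E" shows "adjoint_between N M E F"
  unfolding adjoint_between_def
proof (intro conjI ballI)
  fix f h assume "f \<in> N" "h \<in> M"
  then have "cinner (F h) f = cinner h (E f)" using assms by (simp add: adjoint_between_def)
  then show "cinner (E f) h = cinner f (F h)" by (metis cinner_commute)
qed (use assms in \<open>auto simp: adjoint_between_def\<close>)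

lemma adjoint_between_linear:
  assumes "L2.subspace M" "L2.subspace N" "adjoint_between M N F E" "x \<in> M" "y \<in> M"
  shows "F (x + cscale c y) = F x + cscale c (F y)"
proof (rule cinner_right_eqI[OF assms(2)])
  have F: "F \<in> M \<rightarrow> N" using assms(3) by (simp add: adjoint_between_def)
  have m: "x + cscale c y \<in> M"
    using assms by (intro L2.subspace_add L2.subspace_scale)
  show "F (x + cscale c y) \<in> N" using F m by blast
  show "F x + cscale c (F y) \<in> N"
    using F assms by (intro L2.subspace_add L2.subspace_scale) auto
  fix h assume h: "h \<in> N"
  have "cinner h (F z) = cinner (E h) z" if "z \<in> M" for z
    using adjoint_between_sym[OF assms(3)] h that by (simp add: adjoint_between_def)
  then show "cinner h (F (x + cscale c y)) = cinner h (F x + cscale c (F y))"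
    using m assms(4,5) by (simp add: cinner_add_right cinner_scale_right)
qed

text \<open>Both projections disappear when the inner product is taken with elements of their ranges.\<close>

lemma toeplitz_adjoint:
  assumes "closed_subspace M" "closed_subspace N"
  shows "adjoint_between M N (toeplitz M N \<phi>) (toeplitz N M (cnj_Linf \<phi>))"
  using assms
  by (auto simp: adjoint_between_def toeplitz_def proj_in cinner_proj_left cinner_proj_right
      cinner_mult_op)

lemma toeplitz_bounded:
  assumes "closed_subspace N"
  shows "\<exists>B\<ge>0. \<forall>f\<in>M. norm (toeplitz M N \<phi> f) \<le> B * norm f"
proof -
  obtain B where B: "B \<ge> 0" "\<And>f. norm (mult_op \<phi> f) \<le> B * norm f"
    using norm_mult_op_bounded by blast
  have "norm (toeplitz M N \<phi> f) \<le> B * norm f" if "f \<in> M" for f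
    using norm_proj_le[OF assms, of "mult_op \<phi> f"] B(2)[of f] that
    by (simp add: toeplitz_def)
  with B(1) show ?thesis by blast
qed

section \<open>Transport of complex selfadjointness\<close>

lemma antilinear_unitary_onI:
  assumes C: "antilinear_on K C" and D: "D \<in> K \<rightarrow> K"
    and inv: "\<And>x. x \<in> K \<Longrightarrow> C (D x) = x" "\<And>x. x \<in> K \<Longrightarrow> D (C x) = x"
    and adj: "\<And>f g. f \<in> K \<Longrightarrow> g \<in> K \<Longrightarrow> cinner (C f) g = cnj (cinner f (D g))"
  shows "antilinear_unitary_on K C" "\<And>x. x \<in> K \<Longrightarrow> inv_into K C x = D x"
proof -
  have CK: "C \<in> K \<rightarrow> K" using C by (simp add: antilinear_on_def)
  have bij: "bij_betw C K K"
    using CK D inv(2,1) by (rule bij_betwI)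
  show inv_eq: "inv_into K C x = D x" if "x \<in> K" for x
    using that D inv by (intro inv_into_f_eq bij_betw_imp_inj_on[OF bij]) auto
  show "antilinear_unitary_on K C"
    using C D bij adj by (auto simp: antilinear_unitary_on_def is_antilinear_adjoint_on_def inv_eq)
qed

text \<open>\<open>F\<close> and \<open>G\<close> are inverse to each other, \<open>E\<close> is the adjoint of \<open>F\<close>, and \<open>D\<close> that of \<open>G\<close>. The
  setting is symmetric under exchanging \<open>H, F, E\<close> with \<open>K, G, D\<close>, up to the bounds, which only matter
  for the direction in which operators are transported: \<open>T \<mapsto> E T F\<close>.\<close>

locale adjoint_isomorphism =
  fixes H K :: "L2 set" and F E G D :: "L2 \<Rightarrow> L2"
  assumes subspace_H: "L2.subspace H" and subspace_K: "L2.subspace K"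
    and FE: "adjoint_between K H F E" and GD: "adjoint_between H K G D"
    and GF: "f \<in> K \<Longrightarrow> G (F f) = f" and FG: "h \<in> H \<Longrightarrow> F (G h) = h"
    and E_bounded: "\<exists>B\<ge>0. \<forall>h\<in>H. norm (E h) \<le> B * norm h"
    and F_bounded: "\<exists>B\<ge>0. \<forall>f\<in>K. norm (F f) \<le> B * norm f"
begin

lemma maps [simp]:
  "f \<in> K \<Longrightarrow> F f \<in> H" "h \<in> H \<Longrightarrow> E h \<in> K" "h \<in> H \<Longrightarrow> G h \<in> K" "f \<in> K \<Longrightarrow> D f \<in> H"
  using FE GD by (auto simp: adjoint_between_def)

lemma cinner_F: "f \<in> K \<Longrightarrow> h \<in> H \<Longrightarrow> cinner (F f) h = cinner f (E h)"
  and cinner_E: "h \<in> H \<Longrightarrow> f \<in> K \<Longrightarrow> cinner (E h) f = cinner h (F f)"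
  and cinner_G: "h \<in> H \<Longrightarrow> f \<in> K \<Longrightarrow> cinner (G h) f = cinner h (D f)"
  using FE adjoint_between_sym[OF FE] GD by (auto simp: adjoint_between_def)

text \<open>Taking adjoints in \<open>G F = 1\<close> and \<open>F G = 1\<close> gives \<open>E D = 1\<close> and \<open>D E = 1\<close>.\<close>

lemma ED: "f \<in> K \<Longrightarrow> E (D f) = f"
  by (rule cinner_right_eqI[OF subspace_K])
    (simp_all flip: cinner_F cinner_G add: GF)

lemma DE: "h \<in> H \<Longrightarrow> D (E h) = h"
  by (rule cinner_right_eqI[OF subspace_H])
    (simp_all flip: cinner_F cinner_G add: FG)

lemma linear:
  "x \<in> K \<Longrightarrow> y \<in> K \<Longrightarrow> F (x + cscale c y) = F x + cscale c (F y)"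
  "x \<in> H \<Longrightarrow> y \<in> H \<Longrightarrow> E (x + cscale c y) = E x + cscale c (E y)"
  "x \<in> H \<Longrightarrow> y \<in> H \<Longrightarrow> G (x + cscale c y) = G x + cscale c (G y)"
  using adjoint_between_linear FE GD adjoint_between_sym[OF FE] subspace_H subspace_K by blast+

context
  fixes C C' :: "L2 \<Rightarrow> L2"
  assumes C: "antilinear_unitary_on H C"
    and C': "\<And>f. f \<in> K \<Longrightarrow> C' f = G (C (F f))"
    and C'_alt: "\<And>f. f \<in> K \<Longrightarrow> C' f = E (C (D f))"
begin

lemma C_maps [simp]: "h \<in> H \<Longrightarrow> C h \<in> H" "h \<in> H \<Longrightarrow> inv_into H C h \<in> H"
  using C by (auto simp: antilinear_unitary_on_def antilinear_on_def is_antilinear_adjoint_on_def)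

lemma C_inv [simp]: "h \<in> H \<Longrightarrow> C (inv_into H C h) = h" "h \<in> H \<Longrightarrow> inv_into H C (C h) = h"
  using C by (auto simp: antilinear_unitary_on_def bij_betw_def f_inv_into_f)

text \<open>The two forms of \<open>C'\<close> yield two forms of its inverse; the second one is the antilinear
  adjoint of the first form of \<open>C'\<close>.\<close>

lemma inverse_alt: "g \<in> K \<Longrightarrow> G (inv_into H C (F g)) = E (inv_into H C (D g))"
proof -
  assume g: "g \<in> K"
  let ?x = "E (inv_into H C (D g))"
  have "G (C (F ?x)) = g" using g by (simp flip: C' add: C'_alt DE ED)
  then have "C (F ?x) = F g" using g FG[of "C (F ?x)"] by simp
  then have "F ?x = inv_into H C (F g)" using g C_inv(2)[of "F ?x"] by simp
  then show ?thesis using g GF[of ?x] by simp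
qed

lemma transported_unitary: "antilinear_unitary_on K C'"
  and inv_into_transported: "g \<in> K \<Longrightarrow> inv_into K C' g = G (inv_into H C (F g))"
proof -
  have anti: "C (x + cscale c y) = C x + cscale (cnj c) (C y)" if "x \<in> H" "y \<in> H" for x y c
    using C that by (simp add: antilinear_unitary_on_def antilinear_on_def)
  have adj: "cinner (C x) y = cnj (cinner x (inv_into H C y))" if "x \<in> H" "y \<in> H" for x y
    using C that by (simp add: antilinear_unitary_on_def is_antilinear_adjoint_on_def)
  have "antilinear_on K C'"
    unfolding antilinear_on_def
    using subspace_K
    by (auto simp: C' linear anti L2.subspace_add L2.subspace_scale)
  moreover have "cinner (C' f) g = cnj (cinner f (G (inv_into H C (F g))))"
    if "f \<in> K" "g \<in> K" for f g
    using that by (simp add: C' cinner_G adj cinner_F inverse_alt)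
  ultimately show "antilinear_unitary_on K C'"
    "g \<in> K \<Longrightarrow> inv_into K C' g = G (inv_into H C (F g))"
    using antilinear_unitary_onI[of K C' "\<lambda>g. G (inv_into H C (F g))"]
    by (auto simp: C' FG GF)
qed

text \<open>The two adjoints to be compared are \<open>C' T' C'\<^sup>-\<^sup>1 = (E C D)(E T F)(G C\<^sup>-\<^sup>1 F) = E (C T C\<^sup>-\<^sup>1) F\<close> and
  \<open>T'\<^sup>* = E T\<^sup>* F\<close>; here both forms of \<open>C'\<close> are used, one on each side.\<close>

lemma transported_selfadjoint:
  assumes T': "\<And>f. f \<in> K \<Longrightarrow> T' f = E (T (F f))" and T: "complex_selfadjoint_on H C T"
  shows "complex_selfadjoint_on K C' T'"
proof -
  have T_maps [simp]: "T h \<in> H" if "h \<in> H" for h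
    using T that by (auto simp: complex_selfadjoint_on_def bounded_operator_on_def)
  have T_lin: "T (x + cscale c y) = T x + cscale c (T y)" if "x \<in> H" "y \<in> H" for x y c
    using T that by (simp add: complex_selfadjoint_on_def bounded_operator_on_def)
  have T_adj: "cinner (T x) y = cinner x (C (T (inv_into H C y)))" if "x \<in> H" "y \<in> H" for x y
    using T that by (simp add: complex_selfadjoint_on_def is_adjoint_on_def)
  obtain B where B: "\<And>h. h \<in> H \<Longrightarrow> norm (T h) \<le> B * norm h"
    using T unfolding complex_selfadjoint_on_def bounded_operator_on_def by blast
  obtain BE where BE: "BE \<ge> 0" "\<And>h. h \<in> H \<Longrightarrow> norm (E h) \<le> BE * norm h"
    using E_bounded by blast
  obtain BF where BF: "BF \<ge> 0" "\<And>f. f \<in> K \<Longrightarrow> norm (F f) \<le> BF * norm f"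
    using F_bounded by blast
  have "norm (T' f) \<le> BE * (\<bar>B\<bar> * BF) * norm f" if f: "f \<in> K" for f
  proof -
    have "norm (T (F f)) \<le> B * norm (F f)" using f by (intro B) simp
    also have "\<dots> \<le> \<bar>B\<bar> * (BF * norm f)"
      using f by (intro mult_mono BF) auto
    finally have "BE * norm (T (F f)) \<le> BE * (\<bar>B\<bar> * (BF * norm f))"
      by (intro mult_left_mono BE(1))
    moreover have "norm (T' f) \<le> BE * norm (T (F f))" using f BE(2)[of "T (F f)"] by (simp add: T')
    ultimately show ?thesis by (simp add: mult.assoc)
  qed
  then have "bounded_operator_on K T'"
    unfolding bounded_operator_on_def using subspace_K
    by (auto simp: T' linear T_lin L2.subspace_add L2.subspace_scale)
  moreover have "C' (T' (inv_into K C' g)) = E (C (T (inv_into H C (F g))))" if "g \<in> K" for g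
    using that by (simp add: inv_into_transported T' C'_alt DE FG)
  then have "is_adjoint_on K T' (\<lambda>g. C' (T' (inv_into K C' g)))"
    unfolding is_adjoint_on_def
    by (auto simp: T' cinner_E cinner_F T_adj)
  ultimately show ?thesis
    using transported_unitary by (simp add: complex_selfadjoint_on_def)
qed

end

end

theorem theorem4p5:
  fixes H K :: "L2 set" and \<phi> \<psi> a :: Linf and C\<^sub>H C\<^sub>K E F :: "L2 \<Rightarrow> L2"
  assumes "closed_subspace H" and "closed_subspace K"
    and "GLinf a" and "mult_op a ` K = H"
    and "E = toeplitz H K (cnj_Linf a)" and "F = toeplitz K H a"
    and "\<forall>f\<in>K. toeplitz K K \<phi> f = E (toeplitz H H \<psi> (F f))"
    and "antilinear_unitary_on H C\<^sub>H"
    and "\<forall>f\<in>K. inv_into K F (C\<^sub>H (F f)) = E (C\<^sub>H (inv_into H E f))"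
    and "C\<^sub>K = (\<lambda>f\<in>K. inv_into K F (C\<^sub>H (F f)))"
  shows "antilinear_unitary_on K C\<^sub>K \<and>
    (complex_selfadjoint_on H C\<^sub>H (toeplitz H H \<psi>) \<longleftrightarrow>
     complex_selfadjoint_on K C\<^sub>K (toeplitz K K \<phi>))"
proof -
  note H = assms(1) and K = assms(2)
  obtain b where ba: "\<And>f. mult_op b (mult_op a f) = f" "\<And>f. mult_op a (mult_op b f) = f"
    using GLinf_inverse[OF assms(3)] by blast
  define G where "G = toeplitz H K b"
  define D where "D = toeplitz K H (cnj_Linf b)"
  have F_eq: "F f = mult_op a f" if "f \<in> K" for f
    using that assms(4) H by (auto simp: assms(6) toeplitz_def proj_eq_self)
  have b_in: "mult_op b h \<in> K" if "h \<in> H" for h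
    using that ba assms(4) by auto
  have G_eq: "G h = mult_op b h" if "h \<in> H" for h
    using that b_in K by (simp add: G_def toeplitz_def proj_eq_self)
  have aK: "mult_op a f \<in> H" if "f \<in> K" for f using that assms(4) by blast
  interpret adjoint_isomorphism H K F E G D
  proof
    show "L2.subspace H" "L2.subspace K" using H K by (auto simp: closed_subspace_def)
    show "adjoint_between K H F E" "adjoint_between H K G D"
      unfolding assms(5,6) G_def D_def using H K by (auto intro: toeplitz_adjoint)
    show "\<exists>B\<ge>0. \<forall>h\<in>H. norm (E h) \<le> B * norm h" "\<exists>B\<ge>0. \<forall>f\<in>K. norm (F f) \<le> B * norm f"
      unfolding assms(5,6) using H K by (auto intro: toeplitz_bounded)
  qed (use b_in aK ba in \<open>auto simp: F_eq G_eq\<close>)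
  \<comment> \<open>the same situation with \<open>H\<close> and \<open>K\<close> exchanged, for the converse implication\<close>
  interpret swapped: adjoint_isomorphism K H G D F E
  proof
    show "\<exists>B\<ge>0. \<forall>h\<in>K. norm (D h) \<le> B * norm h" "\<exists>B\<ge>0. \<forall>f\<in>H. norm (G f) \<le> B * norm f"
      unfolding G_def D_def using H K by (auto intro: toeplitz_bounded)
  qed (use subspace_H subspace_K FE GD FG GF in auto)
  have F_inv: "inv_into K F h = G h" if "h \<in> H" for h
    using that FG GF by (intro inv_into_f_eq inj_on_inverseI[where g = G]) auto
  have E_inv: "inv_into H E f = D f" if "f \<in> K" for f
    using that ED DE by (intro inv_into_f_eq inj_on_inverseI[where g = D]) auto
  note C = assms(8)
  have CH: "C\<^sub>H h \<in> H" if "h \<in> H" for h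
    using C that by (auto simp: antilinear_unitary_on_def antilinear_on_def)
  have CK: "C\<^sub>K f = G (C\<^sub>H (F f))" "C\<^sub>K f = E (C\<^sub>H (D f))" if "f \<in> K" for f
    using that assms(9) by (auto simp: assms(10) F_inv E_inv CH)
  note unitary = transported_unitary[OF C CK]
  have CH_eq: "C\<^sub>H h = F (C\<^sub>K (G h))" "C\<^sub>H h = D (C\<^sub>K (E h))" if "h \<in> H" for h
    using that by (simp_all add: CK(1) FG CH) (simp flip: CK(1) add: CK(2) DE CH)
  have T: "toeplitz K K \<phi> f = E (toeplitz H H \<psi> (F f))" if "f \<in> K" for f
    using that assms(7) by blast
  have "toeplitz H H \<psi> h \<in> H" if "h \<in> H" for h
    using that H by (simp add: toeplitz_def proj_in)
  then have T': "toeplitz H H \<psi> h = D (toeplitz K K \<phi> (G h))" if "h \<in> H" for h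
    using that by (simp add: T FG DE)
  show ?thesis
  proof (intro conjI iffI)
    show "antilinear_unitary_on K C\<^sub>K" by (rule unitary)
    show "complex_selfadjoint_on K C\<^sub>K (toeplitz K K \<phi>)"
      if "complex_selfadjoint_on H C\<^sub>H (toeplitz H H \<psi>)"
      using C CK T that by (rule transported_selfadjoint)
    show "complex_selfadjoint_on H C\<^sub>H (toeplitz H H \<psi>)"
      if "complex_selfadjoint_on K C\<^sub>K (toeplitz K K \<phi>)"
      using unitary CH_eq T' that by (rule swapped.transported_selfadjoint)
  qed
qed

end
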